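(* Let $m\in\mathbb Z_{\ge1}$, $\overline l=(l_1,\ldots,l_m)\in\mathbb Z_{\ge1}^m$, $L=\sum_{j=1}^m l_j$, and $\overline\beta=(\beta_1,\ldots,\beta_m)\in(\mathbb C\setminus\{0\})^m$. Let $P(x)\in\mathbb C[x]$ be a polynomial of degree one with $P(k)\neq0$ for all $k\in\mathbb Z_{\ge0}$, put $[P]_n=\prod_{k=0}^{n-1}P(k)$ (so $[P]_0=1$) and $G(t)=\sum_{n=0}^\infty [P]_n t^n\in\mathbb C[[t]]$. Let $\mu\in\mathbb Z_{\ge0}$ and set $$A_{\overline l,\mu,0}(t)=\sum_{i=0}^L\frac{\sigma_i(\overline l,\overline\beta)}{[P]_{i+\mu}}\,t^{L-i}.$$ Then there exist polynomials $A_{\overline l,\mu,j}(t)$ and formal power series $R_{\overline l,\mu,j}(t)$, $j=1,\ldots,m$, such that $$A_{\overline l,\mu,0}(t)G(\beta_jt)-A_{\overline l,\mu,j}(t)=R_{\overline l,\mu,j}(t),$$ where $\deg A_{\overline l,\mu,0}(t)=L$, $\deg A_{\overline l,\mu,j}(t)\le L+\mu-1$, and $\operatorname{ord}_{t=0}R_{\overline l,\mu,j}(t)\ge L+\mu+l_j$.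
   Context: The numbers $\sigma_i=\sigma_i(\overline l,\overline\beta)$, $i=0,\ldots,L$, are defined by the polynomial identity $\prod_{j=1}^m(\beta_j-w)^{l_j}=\sum_{i=0}^L\sigma_iw^i$. *)

theory Defs
  imports Complex_Main
    "HOL-Computational_Algebra.Computational_Algebra"
    "HOL-Library.Extended_Nat"
begin

text \<open>
  Tuples \<open>(x\<^sub>1, \<dots>, x\<^sub>m)\<close> are functions on \<open>nat\<close>, of which only the values at the
  indices \<open>1, \<dots>, m\<close> matter.
\<close>

definition lsum :: "nat \<Rightarrow> (nat \<Rightarrow> nat) \<Rightarrow> nat" where
  "lsum m l = (\<Sum>j=1..m. l j)"

text \<open>
  The polynomial in \<open>w\<close> below has degree \<open>lsum m l\<close>; \<open>[:\<beta> j, -1:]\<close> is \<open>\<beta>\<^sub>j - w\<close>.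
\<close>

definition \<sigma> :: "nat \<Rightarrow> (nat \<Rightarrow> nat) \<Rightarrow> (nat \<Rightarrow> complex) \<Rightarrow> nat \<Rightarrow> complex" where
  "\<sigma> m l \<beta> i = coeff (\<Prod>j=1..m. [:\<beta> j, -1:] ^ l j) i"

definition bracket :: "complex poly \<Rightarrow> nat \<Rightarrow> complex" where
  "bracket P n = (\<Prod>k<n. poly P (of_nat k))"

definition G :: "complex poly \<Rightarrow> complex fps" where
  "G P = Abs_fps (bracket P)"

definition A0 ::
  "complex poly \<Rightarrow> nat \<Rightarrow> (nat \<Rightarrow> nat) \<Rightarrow> (nat \<Rightarrow> complex) \<Rightarrow> nat \<Rightarrow> complex poly" where
  "A0 P m l \<beta> \<mu> =
     (\<Sum>i\<le>lsum m l. monom (\<sigma> m l \<beta> i / bracket P (i + \<mu>)) (lsum m l - i))"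

text \<open>
  The order of vanishing at \<open>0\<close>. The library's \<open>subdegree\<close> is \<open>0\<close> on the zero series,
  whose order is infinite.
\<close>

definition fps_ord :: "complex fps \<Rightarrow> enat" where
  "fps_ord f = (if f = 0 then \<infinity> else enat (subdegree f))"

end

theory Submission
  imports Defs
begin

text \<open>
  For \<open>L + \<mu> \<le> n\<close>, say \<open>n = L + \<mu> + r\<close>, the \<open>n\<close>-th coefficient of \<open>A\<^sub>0(t) G(\<beta>\<^sub>j t)\<close> is
  \<open>\<beta>\<^sub>j\<^bsup>\<mu>+r\<^esup> \<Sum>\<^sub>i \<sigma>\<^sub>i \<beta>\<^sub>j\<^sup>i P(i+\<mu>) \<dots> P(i+\<mu>+r-1)\<close>. Multiplying the \<open>i\<close>-th coefficient
  of a polynomial \<open>F\<close> by \<open>a i + c\<close> amounts to replacing \<open>F\<close> by \<open>a w F' + c F\<close>, which lowers the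
  order of vanishing at \<open>\<beta>\<^sub>j\<close> by at most one. Hence the sum is the value at \<open>\<beta>\<^sub>j\<close> of a
  polynomial vanishing there to order at least \<open>l\<^sub>j - r\<close>, and it is zero for \<open>r < l\<^sub>j\<close>.
  The polynomial \<open>A\<^sub>j\<close> is the truncation of the product below degree \<open>L + \<mu>\<close>.
\<close>

definition euler_op :: "'a::idom \<Rightarrow> 'a \<Rightarrow> 'a poly \<Rightarrow> 'a poly" where
  "euler_op a c F = smult a (pCons 0 (pderiv F)) + smult c F"

lemma coeff_euler_op: "coeff (euler_op a c F) i = (a * of_nat i + c) * coeff F i"
  by (cases i) (auto simp: euler_op_def coeff_pderiv algebra_simps)

text \<open>By the product rule, differentiating \<open>q ^ Suc s * H\<close> costs only one factor
  \<open>q\<close>.\<close>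

lemma power_dvd_euler_op:
  assumes "q ^ Suc s dvd F"
  shows "q ^ s dvd euler_op a c F"
proof -
  obtain H where F: "F = q ^ Suc s * H"
    using assms by (elim dvdE)
  have "pderiv F = q ^ s * (q * pderiv H + smult (of_nat (Suc s)) (pderiv q * H))"
    unfolding F pderiv_mult pderiv_power_Suc by (simp add: algebra_simps)
  then have "q ^ s dvd pderiv F" by simp
  moreover have "pCons 0 (pderiv F) = [:0, 1:] * pderiv F" by simp
  ultimately have "q ^ s dvd pCons 0 (pderiv F)" by (metis dvd_mult)
  moreover have "q ^ s dvd F" unfolding F by simp
  ultimately show ?thesis
    unfolding euler_op_def by (intro dvd_add dvd_smult)
qed

text \<open>Each linear factor of the weight is one application of \<open>euler_op\<close> and costs
  one power of \<open>q\<close>; hence the induction on \<open>r\<close> has to leave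
  \<open>s\<close> arbitrary.\<close>

lemma power_dvd_coeff_weighted:
  fixes F :: "'a::idom poly"
  assumes "q ^ (s + r) dvd F"
  shows "\<exists>H. q ^ s dvd H \<and>
    (\<forall>i. coeff H i = (\<Prod>k<r. a * of_nat i + c k) * coeff F i)"
  using assms
proof (induction r arbitrary: s)
  case 0
  then show ?case by auto
next
  case (Suc r)
  from Suc.prems have "q ^ (Suc s + r) dvd F" by simp
  from Suc.IH[OF this] obtain H where H: "q ^ Suc s dvd H"
    "\<And>i. coeff H i = (\<Prod>k<r. a * of_nat i + c k) * coeff F i" by blast
  show ?case
    by (intro exI[of _ "euler_op a (c r) H"] conjI allI power_dvd_euler_op H(1))
      (simp add: coeff_euler_op H(2) mult_ac)
qed

lemma sum_coeff_weighted_eq_0: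
  fixes F :: "'a::idom poly"
  assumes "q ^ n dvd F" "poly q x = 0" "r < n" "degree F \<le> d"
  shows "(\<Sum>i\<le>d. coeff F i * x ^ i * (\<Prod>k<r. a * of_nat i + c k)) = 0"
proof -
  \<comment> \<open>One factor \<open>q\<close> has to survive the \<open>r\<close> applications,
    which is where \<open>r < n\<close> enters.\<close>
  have "q ^ (1 + r) dvd F"
    by (rule dvd_trans[OF le_imp_power_dvd assms(1)]) (use assms(3) in simp)
  from power_dvd_coeff_weighted[OF this] obtain H where H: "q dvd H"
    "\<And>i. coeff H i = (\<Prod>k<r. a * of_nat i + c k) * coeff F i" by (metis power_one_right)
  have "degree H \<le> d"
    using assms(4) by (intro degree_le) (auto simp: H(2) coeff_eq_0)
  then have "(\<Sum>i\<le>d. coeff H i * x ^ i) = poly H x"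
    unfolding poly_altdef
    by (intro sum.mono_neutral_right) (auto simp: coeff_eq_0)
  also have "\<dots> = 0"
    using H(1) assms(2) by (auto elim!: dvdE)
  finally show ?thesis by (simp add: H(2) mult_ac)
qed

lemma degree_prod_linear_le:
  fixes \<beta> :: "nat \<Rightarrow> complex"
  shows "degree (\<Prod>j=1..m. [:\<beta> j, -1:] ^ l j) \<le> lsum m l"
proof -
  have "degree (\<Prod>j=1..m. [:\<beta> j, -1:] ^ l j) \<le> (\<Sum>j=1..m. degree ([:\<beta> j, -1:] ^ l j))"
    using degree_prod_sum_le[of "{1..m}" "\<lambda>j. [:\<beta> j, -1:] ^ l j"] by (simp add: o_def)
  also have "\<dots> = lsum m l"
    by (simp add: lsum_def degree_power_eq)
  finally show ?thesis .
qed

lemma sigma_0: "\<sigma> m l \<beta> 0 = (\<Prod>j=1..m. \<beta> j ^ l j)"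
  by (simp add: \<sigma>_def poly_0_coeff_0[symmetric] poly_prod)

lemma bracket_add: "bracket P (n + r) = bracket P n * (\<Prod>k<r. poly P (of_nat (n + k)))"
  by (induction r) (simp_all add: bracket_def mult_ac)

lemma bracket_nonzero:
  assumes "\<And>k::nat. poly P (of_nat k) \<noteq> 0"
  shows "bracket P n \<noteq> 0"
  using assms by (simp add: bracket_def)

text \<open>Only \<open>i = 0\<close> contributes to the top coefficient, and \<sigma>_0 is a
  product of powers of the nonzero \<open>\<beta> j\<close>.\<close>

lemma degree_A0:
  assumes "\<And>j. j \<in> {1..m} \<Longrightarrow> \<beta> j \<noteq> 0" "\<And>k::nat. poly P (of_nat k) \<noteq> 0"
  shows "degree (A0 P m l \<beta> \<mu>) = lsum m l"
proof (rule antisym)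
  show "degree (A0 P m l \<beta> \<mu>) \<le> lsum m l"
    unfolding A0_def
    by (intro degree_sum_le) (auto intro: order_trans[OF degree_monom_le])
  have "coeff (A0 P m l \<beta> \<mu>) (lsum m l) =
      (\<Sum>i\<le>lsum m l. if i = 0 then \<sigma> m l \<beta> i / bracket P (i + \<mu>) else 0)"
    unfolding A0_def coeff_sum by (intro sum.cong) auto
  also have "\<dots> = \<sigma> m l \<beta> 0 / bracket P \<mu>"
    by simp
  also have "\<dots> \<noteq> 0"
    using assms bracket_nonzero[of P \<mu>] by (simp add: sigma_0)
  finally show "lsum m l \<le> degree (A0 P m l \<beta> \<mu>)"
    by (rule le_degree)
qed

text \<open>Multiplying by the monomial of index \<open>i\<close> shifts the series by
  \<open>lsum m l - i\<close>. Since \<open>lsum m l \<le> n\<close>, every shift is at most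
  \<open>n\<close>, so no term drops out.\<close>

lemma nth_A0_mult_G:
  assumes "lsum m l \<le> n"
  shows "fps_nth (fps_of_poly (A0 P m l \<beta> \<mu>) * (G P oo (fps_const b * fps_X))) n =
    (\<Sum>i\<le>lsum m l. \<sigma> m l \<beta> i / bracket P (i + \<mu>) *
       (b ^ (n - lsum m l + i) * bracket P (n - lsum m l + i)))"
proof -
  have "n - (lsum m l - i) = n - lsum m l + i" if "i \<le> lsum m l" for i
    using that assms by simp
  moreover have "\<not> n < lsum m l - i" for i using assms by simp
  ultimately show ?thesis
    unfolding A0_def G_def fps_compose_linear
    by (simp add: fps_of_poly_sum fps_of_poly_monom sum_distrib_right fps_sum_nth
        mult.assoc fps_X_power_mult_nth)
qed

lemma nth_A0_mult_G_eq_0: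
  assumes "j \<in> {1..m}" "degree P = 1" "\<And>k::nat. poly P (of_nat k) \<noteq> 0" "r < l j"
  shows "fps_nth (fps_of_poly (A0 P m l \<beta> \<mu>) * (G P oo (fps_const (\<beta> j) * fps_X)))
    (lsum m l + \<mu> + r) = 0"
proof -
  define F where "F = (\<Prod>j=1..m. [:\<beta> j, -1:] ^ l j)"
  define a c where "a = coeff P 1" and "c = coeff P 0"
  then have P: "P = [:c, a:]"
    using assms(2) by (intro poly_eqI) (auto simp: coeff_pCons coeff_eq_0 split: nat.split)
  have F: "[:\<beta> j, -1:] ^ l j dvd F" "degree F \<le> lsum m l"
    using assms(1) degree_prod_linear_le[of \<beta> l m] by (auto simp: F_def)
  \<comment> \<open>The quotient of the brackets leaves the \<open>r\<close> values of
    \<open>P\<close> at \<open>i + \<mu> + k\<close>; each is affine in \<open>i\<close> with the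
    same slope \<open>a\<close>, the form that the weighted sum requires.\<close>
  have summand: "\<sigma> m l \<beta> i / bracket P (i + \<mu>) * (\<beta> j ^ (\<mu> + r + i) * bracket P (\<mu> + r + i)) =
      \<beta> j ^ (\<mu> + r) *
        (coeff F i * \<beta> j ^ i * (\<Prod>k<r. a * of_nat i + (a * of_nat (\<mu> + k) + c)))" for i
  proof -
    have "bracket P (\<mu> + r + i) = bracket P (i + \<mu>) * (\<Prod>k<r. poly P (of_nat (i + \<mu> + k)))"
      using bracket_add[of P "i + \<mu>" r] by (simp add: ac_simps)
    moreover have "(\<Prod>k<r. poly P (of_nat (i + \<mu> + k))) =
        (\<Prod>k<r. a * of_nat i + (a * of_nat (\<mu> + k) + c))"
      by (simp add: P algebra_simps)
    moreover note bracket_nonzero[OF assms(3), of "i + \<mu>"]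
    ultimately show ?thesis
      by (simp add: \<sigma>_def F_def power_add)
  qed
  have "fps_nth (fps_of_poly (A0 P m l \<beta> \<mu>) * (G P oo (fps_const (\<beta> j) * fps_X)))
      (lsum m l + \<mu> + r) =
    \<beta> j ^ (\<mu> + r) * (\<Sum>i\<le>lsum m l.
      coeff F i * \<beta> j ^ i * (\<Prod>k<r. a * of_nat i + (a * of_nat (\<mu> + k) + c)))"
    unfolding sum_distrib_left summand[symmetric] by (simp add: nth_A0_mult_G)
  also have "\<dots> = 0"
    by (subst sum_coeff_weighted_eq_0[OF F(1) _ assms(4) F(2)]) simp_all
  finally show ?thesis .
qed

lemma coeff_sum_monom_fps_nth:
  "coeff (\<Sum>k<n. monom (fps_nth f k) k) i = (if i < n then fps_nth f i else 0)"
  by (simp add: coeff_sum)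

text \<open>For \<open>n = 0\<close> the sum is empty and its degree 0 agrees with the truncated
  \<open>n - 1\<close>.\<close>

lemma degree_sum_monom_less: "degree (\<Sum>k<n. monom (f k) k) \<le> n - 1"
  by (intro degree_sum_le) (auto intro: order_trans[OF degree_monom_le])

text \<open>The zero series satisfies every such bound, its order being infinite.\<close>

lemma fps_ord_geI:
  assumes "\<And>n. n < d \<Longrightarrow> fps_nth f n = 0"
  shows "fps_ord f \<ge> enat d"
  using assms by (auto simp: fps_ord_def intro: subdegree_geI)

theorem theorem3:
  fixes m :: nat and l :: "nat \<Rightarrow> nat" and \<beta> :: "nat \<Rightarrow> complex"
    and P :: "complex poly" and \<mu> :: nat
  assumes "m \<ge> 1"
    and "\<And>j. j \<in> {1..m} \<Longrightarrow> l j \<ge> 1"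
    and "\<And>j. j \<in> {1..m} \<Longrightarrow> \<beta> j \<noteq> 0"
    and "degree P = 1"
    and "\<And>k::nat. poly P (of_nat k) \<noteq> 0"
  shows "\<exists>(A :: nat \<Rightarrow> complex poly) (R :: nat \<Rightarrow> complex fps).
    degree (A0 P m l \<beta> \<mu>) = lsum m l \<and>
    (\<forall>j\<in>{1..m}.
       fps_of_poly (A0 P m l \<beta> \<mu>) * (G P oo (fps_const (\<beta> j) * fps_X)) - fps_of_poly (A j) = R j \<and>
       degree (A j) \<le> lsum m l + \<mu> - 1 \<and>
       fps_ord (R j) \<ge> enat (lsum m l + \<mu> + l j))"
proof -
  define H where "H j = fps_of_poly (A0 P m l \<beta> \<mu>) * (G P oo (fps_const (\<beta> j) * fps_X))" for j
  define A where "A j = (\<Sum>k<lsum m l + \<mu>. monom (fps_nth (H j) k) k)" for j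
  have "fps_ord (H j - fps_of_poly (A j)) \<ge> enat (lsum m l + \<mu> + l j)" if j: "j \<in> {1..m}" for j
  proof (rule fps_ord_geI)
    fix n assume n: "n < lsum m l + \<mu> + l j"
    show "fps_nth (H j - fps_of_poly (A j)) n = 0"
    \<comment> \<open>In the first range \<open>A j\<close> cancels \<open>H j\<close>; in the
      second \<open>A j\<close> has no terms and the coefficient of \<open>H j\<close> itself
      vanishes.\<close>
    proof (cases "n < lsum m l + \<mu>")
      case True
      then show ?thesis by (simp add: A_def coeff_sum_monom_fps_nth)
    next
      case False
      then obtain r where r: "n = lsum m l + \<mu> + r"
        using le_Suc_ex not_less by blast
      with n have "r < l j" by simp
      from nth_A0_mult_G_eq_0[where l = l, OF j assms(4,5) this]
      show ?thesis by (simp add: A_def coeff_sum_monom_fps_nth H_def r)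
    qed
  qed
  moreover have "degree (A j) \<le> lsum m l + \<mu> - 1" for j
    unfolding A_def by (rule degree_sum_monom_less)
  moreover have "degree (A0 P m l \<beta> \<mu>) = lsum m l"
    using assms(3,5) by (rule degree_A0)
  ultimately show ?thesis
    by (intro exI[of _ A] exI[of _ "\<lambda>j. H j - fps_of_poly (A j)"]) (simp add: H_def)
qed

end
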